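(* Let $A\in\mathbb{R}^{m\times n}$, and let $S$, $\kappa(A)$, the vectors $a_i$, $b_k$, $e_j$, $\mathbf{1}_m$, $\mathbf{1}_n$ and the index sets $I(x)$, $K(y)$, $J(x,y)$ be as defined in the context. Assume that $(\Delta_m\times\Delta_n)\setminus S\neq\emptyset$. Then $$\kappa(A)=\sup_{(x,y)\in(\Delta_m\times\Delta_n)\setminus S}\Big[\operatorname{dist}\Big(0;\ \operatorname{co}\{(a_i,b_k) : i\in I(x),\,k\in K(y)\}+\operatorname{span}\{\mathbf{1}_m\}\times\operatorname{span}\{\mathbf{1}_n\}-\operatorname{cone}\big[\operatorname{co}\{e_j : j\in J(x,y)\}\big]\Big)\Big]^{-1}.$$
   Context: All norms are Euclidean and $\operatorname{dist}(\cdot\,;C)$ is the Euclidean distance to a set $C$. $\Delta_m=\{x\in\mathbb{R}^m : \sum_{i=1}^m x_i=1,\ x\ge 0\}$, and similarly $\Delta_n\subset\mathbb{R}^n$. For $(x,y)\in\mathbb{R}^m\times\mathbb{R}^n$ let $$F(x,y):=\max\{x^{T}Av-u^{T}Ay : (u,v)\in\Delta_m\times\Delta_n\}.$$ One has $\min_{\Delta_m\times\Delta_n}F=0$. Let $S:=\{(x,y)\in\Delta_m\times\Delta_n : F(x,y)=0\}$ and $$\kappa(A):=\inf\{\kappa\ge 0 : \operatorname{dist}((x,y);S)\le\kappa F(x,y)\ \text{for all }(x,y)\in\Delta_m\times\Delta_n\}.$$ Let $a_1,\dots,a_n\in\mathbb{R}^m$ be the columns of $A$ and let $-b_1^{T},\dots,-b_m^{T}$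 be the rows of $A$ (so $b_k\in\mathbb{R}^n$). Let $e_1,\dots,e_{m+n}$ be the standard unit vectors of $\mathbb{R}^{m+n}=\mathbb{R}^m\times\mathbb{R}^n$, and let $\mathbf{1}_p\in\mathbb{R}^p$ be the all-ones vector. For $(x,y)\in\Delta_m\times\Delta_n$ put $$I(x):=\{\bar\imath\in\{1,\dots,n\} : a_{\bar\imath}^{T}x=\max_{1\le i\le n}a_i^{T}x\},\qquad K(y):=\{\bar k\in\{1,\dots,m\} : b_{\bar k}^{T}y=\max_{1\le k\le m}b_k^{T}y\},$$ $$J(x,y):=\{j\in\{1,\dots,m\} : x_j=0\}\cup\{m+p : p\in\{1,\dots,n\},\ y_p=0\}.$$ The symbols $\operatorname{span}$, $\operatorname{cone}$, $\operatorname{co}$ denote linear, conic, and convex hulls; sums and differences of sets are in the Minkowski sense. The conic hull contains $0$, and $\operatorname{cone}[\operatorname{co}\emptyset]=\{0\}$. *)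

theory Defs
  imports "HOL-Analysis.Analysis"
begin

definition prob_simplex :: "(real^'k::finite) set" where
  "prob_simplex = {x. (\<Sum>i\<in>UNIV. x $ i) = 1 \<and> (\<forall>i. 0 \<le> x $ i)}"

definition strategies :: "((real^'m::finite) \<times> (real^'n::finite)) set" where
  "strategies = prob_simplex \<times> prob_simplex"

text \<open>The supremum is over a compact set and is attained, see \<open>gap_fun_is_max\<close> below.\<close>

definition gap_fun :: "real^'n::finite^'m::finite \<Rightarrow> (real^'m) \<times> (real^'n) \<Rightarrow> real" where
  "gap_fun A = (\<lambda>(x, y). SUP (u, v)\<in>strategies. x \<bullet> (A *v v) - u \<bullet> (A *v y))"

definition solution_set :: "real^'n::finite^'m::finite \<Rightarrow> ((real^'m) \<times> (real^'n)) set" where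
  "solution_set A = {z \<in> strategies. gap_fun A z = 0}"

text \<open>Taken in the extended reals, so that the infimum of the empty set is \<open>\<infinity>\<close>.\<close>

definition cond_measure :: "real^'n::finite^'m::finite \<Rightarrow> ereal" where
  "cond_measure A =
     Inf (ereal ` {\<kappa>. 0 \<le> \<kappa> \<and> (\<forall>z\<in>strategies. infdist z (solution_set A) \<le> \<kappa> * gap_fun A z)})"

definition avec :: "real^'n::finite^'m::finite \<Rightarrow> 'n \<Rightarrow> real^'m" where
  "avec A i = column i A"

definition bvec :: "real^'n::finite^'m::finite \<Rightarrow> 'm \<Rightarrow> real^'n" where
  "bvec A k = - row k A"

text \<open>The index set \<open>{1..m+n}\<close> of the unit vectors is rendered as the sum type \<open>'m + 'n\<close>.\<close>

definition unit_vec :: "'m::finite + 'n::finite \<Rightarrow> (real^'m) \<times> (real^'n)" where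
  "unit_vec j = (case j of Inl i \<Rightarrow> (axis i 1, 0) | Inr p \<Rightarrow> (0, axis p 1))"

definition I_set :: "real^'n::finite^'m::finite \<Rightarrow> real^'m \<Rightarrow> 'n set" where
  "I_set A x = {i. avec A i \<bullet> x = (MAX i'. avec A i' \<bullet> x)}"

definition K_set :: "real^'n::finite^'m::finite \<Rightarrow> real^'n \<Rightarrow> 'm set" where
  "K_set A y = {k. bvec A k \<bullet> y = (MAX k'. bvec A k' \<bullet> y)}"

definition J_set :: "(real^'m::finite) \<times> (real^'n::finite) \<Rightarrow> ('m + 'n) set" where
  "J_set = (\<lambda>(x, y). Inl ` {j. x $ j = 0} \<union> Inr ` {p. y $ p = 0})"

text \<open>The library's conic hull of the empty set is empty; here it has to be \<open>{0}\<close>.\<close>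

definition cone_of :: "'a::real_vector set \<Rightarrow> 'a set" where
  "cone_of C = insert 0 (conic hull C)"

text \<open>On sets, \<open>-\<close> is set difference, so the Minkowski sum and difference are written out.\<close>

definition subdiff_set ::
    "real^'n::finite^'m::finite \<Rightarrow> (real^'m) \<times> (real^'n) \<Rightarrow> ((real^'m) \<times> (real^'n)) set" where
  "subdiff_set A = (\<lambda>(x, y).
     {g + s - c | g s c.
        g \<in> convex hull {(avec A i, bvec A k) | i k. i \<in> I_set A x \<and> k \<in> K_set A y} \<and>
        s \<in> span {vec 1} \<times> span {vec 1} \<and>
        c \<in> cone_of (convex hull (unit_vec ` J_set (x, y)))})"

lemma compact_prob_simplex: "compact (prob_simplex :: (real^'k::finite) set)"
proof -
  have "closed {x :: real^'k. (\<Sum>i\<in>UNIV. x $ i) = 1}"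
    by (intro closed_Collect_eq continuous_intros)
  moreover have "closed {x :: real^'k. \<forall>i. 0 \<le> x $ i}"
    by (intro closed_Collect_all closed_Collect_le continuous_intros)
  ultimately have "closed (prob_simplex :: (real^'k) set)"
    unfolding prob_simplex_def by (rule closed_Collect_conj)
  moreover have "bounded (prob_simplex :: (real^'k) set)"
    unfolding bounded_iff
  proof (intro exI ballI)
    fix x :: "real^'k" assume "x \<in> prob_simplex"
    then show "norm x \<le> 1"
      using norm_le_l1_cart[of x] by (simp add: prob_simplex_def)
  qed
  ultimately show ?thesis by (simp add: compact_eq_bounded_closed)
qed

lemma prob_simplex_nonempty: "(prob_simplex :: (real^'k::finite) set) \<noteq> {}"
proof -
  have "axis undefined 1 \<in> (prob_simplex :: (real^'k) set)"
    by (simp add: prob_simplex_def axis_def)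
  then show ?thesis by blast
qed

lemma gap_fun_is_max:
  fixes A :: "real^'n::finite^'m::finite"
  shows "\<exists>(u, v)\<in>strategies. gap_fun A (x, y) = x \<bullet> (A *v v) - u \<bullet> (A *v y) \<and>
           (\<forall>(u', v')\<in>strategies. x \<bullet> (A *v v') - u' \<bullet> (A *v y) \<le> x \<bullet> (A *v v) - u \<bullet> (A *v y))"
proof -
  let ?f = "\<lambda>w :: (real^'m) \<times> (real^'n). x \<bullet> (A *v snd w) - fst w \<bullet> (A *v y)"
  have "compact (strategies :: ((real^'m) \<times> (real^'n)) set)" "(strategies :: ((real^'m) \<times> (real^'n)) set) \<noteq> {}"
    unfolding strategies_def
    by (simp_all add: compact_Times compact_prob_simplex prob_simplex_nonempty)
  moreover have "continuous_on strategies ?f"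
    by (intro continuous_on_diff continuous_on_inner continuous_on_const continuous_on_fst continuous_on_id
        continuous_on_snd bounded_linear.continuous_on[OF matrix_vector_mul_bounded_linear])
  ultimately have "\<exists>w\<in>strategies. \<forall>w'\<in>strategies. ?f w' \<le> ?f w"
    by (rule continuous_attains_sup)
  then obtain w where w: "w \<in> strategies" "\<forall>w'\<in>strategies. ?f w' \<le> ?f w"
    by blast
  have "gap_fun A (x, y) = Sup (?f ` strategies)"
    by (simp add: gap_fun_def case_prod_unfold)
  also have "\<dots> = ?f w"
    by (rule cSup_eq_maximum) (use w in auto)
  finally have "gap_fun A (x, y) = ?f w" .
  then show ?thesis
    using w unfolding case_prod_unfold by blast
qed

end

theory Submission
  imports Defs
begin

text \<open>
  The set \<open>subdiff_set A z\<close> is the subdifferential at \<open>z\<close> of the polyhedral convex function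
  \<open>F = gap_fun A\<close> restricted to the product of simplices.

  For a solution \<open>s\<close> and a subgradient \<open>g\<close> at \<open>z\<close> we have
  \<open>F z \<le> g \<bullet> (z - s) \<le> norm g * dist z s\<close>, so every error bound constant dominates the inverse
  distances. Conversely, if the error bound with constant \<open>\<kappa>\<close> fails at \<open>z\<close>, then a minimizer \<open>w\<close> of
  \<open>F w + dist w z / \<kappa>\<close> (Ekeland's perturbation) is not a solution, and the projection of \<open>0\<close> onto the
  subdifferential at \<open>w\<close> would be a descent direction if it were longer than \<open>1 / \<kappa>\<close>.

  Solutions exist by the same descent argument: the mixed strategies that represent a subgradient
  \<open>g\<close> at \<open>w\<close> form a point \<open>u\<close> with \<open>F w \<le> g \<bullet> (w - u)\<close>, so that the subgradients at a minimizer
  would be bounded away from \<open>0\<close> if the minimum were positive.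
\<close>

section \<open>The gap function as a finite maximum\<close>

lemma compact_strategies: "compact (strategies :: ((real^'m::finite) \<times> (real^'n::finite)) set)"
  unfolding strategies_def by (simp add: compact_Times compact_prob_simplex)

lemma strategies_nonempty: "(strategies :: ((real^'m::finite) \<times> (real^'n::finite)) set) \<noteq> {}"
  unfolding strategies_def by (simp add: prob_simplex_nonempty)

lemma convex_prob_simplex: "convex (prob_simplex :: (real^'k::finite) set)"
  unfolding convex_def prob_simplex_def
  by (auto simp: sum.distrib simp flip: sum_distrib_left)

lemma convex_strategies: "convex (strategies :: ((real^'m::finite) \<times> (real^'n::finite)) set)"
  unfolding strategies_def by (intro convex_Times convex_prob_simplex)

lemma axis_in_prob_simplex: "axis k 1 \<in> prob_simplex"
  by (simp add: prob_simplex_def axis_def)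

lemma norm_strategies_le:
  assumes "z \<in> strategies"
  shows "norm z \<le> 2"
proof -
  have 1: "norm x \<le> 1" if "x \<in> prob_simplex" for x :: "real^'k::finite"
    using that norm_le_l1_cart[of x] by (simp add: prob_simplex_def)
  obtain x y where z: "z = (x, y)" "x \<in> prob_simplex" "y \<in> prob_simplex"
    using assms by (auto simp: strategies_def)
  have "norm z \<le> norm x + norm y"
    unfolding z(1) by (rule norm_Pair_le)
  with 1[OF z(2)] 1[OF z(3)] show ?thesis by linarith
qed

lemma inner_matrix_vector_mult_avec:
  fixes A :: "real^'n::finite^'m::finite"
  shows "x \<bullet> (A *v v) = (\<Sum>i\<in>UNIV. v $ i * (avec A i \<bullet> x))"
  by (simp add: avec_def matrix_mult_sum inner_sum_right scalar_mult_eq_scaleR inner_commute)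

lemma inner_matrix_vector_mult_bvec:
  fixes A :: "real^'n::finite^'m::finite"
  shows "- (u \<bullet> (A *v y)) = (\<Sum>k\<in>UNIV. u $ k * (bvec A k \<bullet> y))"
  by (simp add: bvec_def matrix_mult_dot inner_vec_def[of u] row_def sum_negf)

lemma prob_simplex_sum_le:
  assumes "v \<in> prob_simplex" "\<And>i. f i \<le> c"
  shows "(\<Sum>i\<in>UNIV. v $ i * f i) \<le> c"
proof -
  have "(\<Sum>i\<in>UNIV. v $ i * f i) \<le> (\<Sum>i\<in>UNIV. v $ i * c)"
    using assms by (intro sum_mono mult_left_mono) (auto simp: prob_simplex_def)
  also have "\<dots> = c"
    using assms by (simp add: prob_simplex_def flip: sum_distrib_right)
  finally show ?thesis .
qed

lemma gap_fun_upper: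
  fixes A :: "real^'n::finite^'m::finite"
  assumes "(u, v) \<in> strategies"
  shows "x \<bullet> (A *v v) - u \<bullet> (A *v y) \<le> gap_fun A (x, y)"
  using gap_fun_is_max[of A x y] assms by (auto simp: case_prod_unfold)

lemma gap_fun_ge:
  fixes A :: "real^'n::finite^'m::finite"
  shows "(avec A i, bvec A k) \<bullet> z \<le> gap_fun A z"
proof -
  obtain x y where z: "z = (x, y)" by (cases z)
  have "(axis k 1, axis i 1) \<in> (strategies :: ((real^'m) \<times> (real^'n)) set)"
    by (simp add: strategies_def axis_in_prob_simplex)
  from gap_fun_upper[OF this, of x A y] show ?thesis
    by (simp add: z inner_axis' matrix_vector_mult_basis avec_def bvec_def inner_commute
        matrix_vector_mul_component row_def)
qed

text \<open>A linear functional on a simplex is maximal at a vertex, and \<open>u\<close> and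
  \<open>v\<close> occur in separate terms, so the maximum over mixed strategies splits into two
  maxima over pure ones.\<close>

lemma gap_fun_eq_Max:
  fixes A :: "real^'n::finite^'m::finite"
  shows "gap_fun A (x, y) = (MAX i. avec A i \<bullet> x) + (MAX k. bvec A k \<bullet> y)"
proof (rule antisym)
  obtain u v where uv: "(u, v) \<in> strategies" "gap_fun A (x, y) = x \<bullet> (A *v v) - u \<bullet> (A *v y)"
    using gap_fun_is_max[of A x y] by (auto simp: case_prod_unfold)
  have "x \<bullet> (A *v v) \<le> (MAX i. avec A i \<bullet> x)"
    unfolding inner_matrix_vector_mult_avec
    using uv by (intro prob_simplex_sum_le) (auto simp: strategies_def)
  moreover have "- (u \<bullet> (A *v y)) \<le> (MAX k. bvec A k \<bullet> y)"
    unfolding inner_matrix_vector_mult_bvec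
    using uv by (intro prob_simplex_sum_le) (auto simp: strategies_def)
  ultimately show "gap_fun A (x, y) \<le> (MAX i. avec A i \<bullet> x) + (MAX k. bvec A k \<bullet> y)"
    using uv by linarith
next
  have "(MAX i. avec A i \<bullet> x) \<in> range (\<lambda>i. avec A i \<bullet> x)"
    "(MAX k. bvec A k \<bullet> y) \<in> range (\<lambda>k. bvec A k \<bullet> y)"
    by (auto intro!: Max_in)
  then obtain i k where "(MAX i. avec A i \<bullet> x) = avec A i \<bullet> x" "(MAX k. bvec A k \<bullet> y) = bvec A k \<bullet> y"
    by blast
  with gap_fun_ge[of A i k "(x, y)"]
  show "(MAX i. avec A i \<bullet> x) + (MAX k. bvec A k \<bullet> y) \<le> gap_fun A (x, y)"
    by simp
qed

text \<open>Each summand is at most its own maximum, so the sum reaches \<open>gap_fun A z\<close>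
  only if both summands are maximal. Hence the pairs from \<open>I_set\<close> and
  \<open>K_set\<close> index exactly the linear pieces active at \<open>z\<close>.\<close>

lemma active_iff:
  fixes A :: "real^'n::finite^'m::finite"
  shows "i \<in> I_set A (fst z) \<and> k \<in> K_set A (snd z) \<longleftrightarrow> (avec A i, bvec A k) \<bullet> z = gap_fun A z"
proof -
  obtain x y where z: "z = (x, y)" by (cases z)
  have "avec A i \<bullet> x \<le> (MAX i. avec A i \<bullet> x)" "bvec A k \<bullet> y \<le> (MAX k. bvec A k \<bullet> y)"
    by simp_all
  then show ?thesis
    unfolding z I_set_def K_set_def gap_fun_eq_Max fst_conv snd_conv mem_Collect_eq inner_Pair
    by (intro iffI conjI; linarith)
qed

lemma ex_active:
  fixes A :: "real^'n::finite^'m::finite"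
  shows "\<exists>i k. (avec A i, bvec A k) \<bullet> z = gap_fun A z"
proof -
  obtain x y where z: "z = (x, y)" by (cases z)
  have "(MAX i. avec A i \<bullet> x) \<in> range (\<lambda>i. avec A i \<bullet> x)"
    "(MAX k. bvec A k \<bullet> y) \<in> range (\<lambda>k. bvec A k \<bullet> y)"
    by (auto intro!: Max_in)
  then obtain i k where "(MAX i. avec A i \<bullet> x) = avec A i \<bullet> x" "(MAX k. bvec A k \<bullet> y) = bvec A k \<bullet> y"
    by blast
  then have "(avec A i, bvec A k) \<bullet> z = gap_fun A z"
    unfolding z gap_fun_eq_Max by simp
  then show ?thesis by blast
qed

lemma gap_fun_le_iff:
  fixes A :: "real^'n::finite^'m::finite"
  shows "gap_fun A z \<le> c \<longleftrightarrow> (\<forall>i k. (avec A i, bvec A k) \<bullet> z \<le> c)"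
  using ex_active[of A z] gap_fun_ge[of A _ _ z] by (metis order_trans)

text \<open>Replying to \<open>z\<close> with \<open>z\<close> itself makes the two payoff terms
  cancel.\<close>

lemma gap_fun_nonneg:
  assumes "z \<in> strategies"
  shows "0 \<le> gap_fun A z"
  using gap_fun_upper[of "fst z" "snd z" "fst z" A "snd z"] assms by simp

lemma convex_on_gap_fun:
  fixes A :: "real^'n::finite^'m::finite"
  shows "convex_on UNIV (gap_fun A)"
proof (rule convex_onI)
  fix t :: real and z w :: "(real^'m) \<times> (real^'n)"
  assume t: "0 < t" "t < 1"
  have "(1 - t) * ((avec A i, bvec A k) \<bullet> z) + t * ((avec A i, bvec A k) \<bullet> w)
      \<le> (1 - t) * gap_fun A z + t * gap_fun A w" for i k
    using t by (intro add_mono mult_left_mono gap_fun_ge) auto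
  then show "gap_fun A ((1 - t) *\<^sub>R z + t *\<^sub>R w) \<le> (1 - t) * gap_fun A z + t * gap_fun A w"
    unfolding gap_fun_le_iff by (simp only: inner_add_right inner_scaleR_right) blast
qed simp

lemma continuous_on_gap_fun: "continuous_on T (gap_fun A)"
  using convex_on_continuous[OF open_UNIV convex_on_gap_fun] continuous_on_subset by blast

section \<open>Subgradients\<close>

text \<open>A single equation replaces membership in \<open>I_set\<close> and \<open>K_set\<close>,
  because the estimates below need only the value of a whole linear piece at
  \<open>z\<close>.\<close>

definition active_vecs ::
    "real^'n::finite^'m::finite \<Rightarrow> (real^'m) \<times> (real^'n) \<Rightarrow> ((real^'m) \<times> (real^'n)) set" where
  "active_vecs A z = {(avec A i, bvec A k) | i k. (avec A i, bvec A k) \<bullet> z = gap_fun A z}"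

lemma subdiff_set_eq:
  "subdiff_set A z = {g + s - c | g s c. g \<in> convex hull active_vecs A z \<and>
     s \<in> span {vec 1} \<times> span {vec 1} \<and> c \<in> cone_of (convex hull (unit_vec ` J_set z))}"
  by (simp add: subdiff_set_def active_vecs_def case_prod_unfold active_iff)

lemma subdiff_setI:
  assumes "g \<in> convex hull active_vecs A z" "s \<in> span {vec 1} \<times> span {vec 1}"
    "c \<in> cone_of (convex hull (unit_vec ` J_set z))"
  shows "g + s - c \<in> subdiff_set A z"
  using assms unfolding subdiff_set_eq by blast

lemma zero_in_span_Times: "0 \<in> span S \<times> span T"
  by (simp add: zero_prod_def span_zero)

lemma zero_in_cone_of: "0 \<in> cone_of C"
  by (simp add: cone_of_def)

lemma cone_of_eq: "cone_of C = (if C = {} then {0} else conic hull C)"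
  by (force simp: cone_of_def conic_hull_explicit)

lemma convex_cone_of: "convex C \<Longrightarrow> convex (cone_of C)"
  by (simp add: cone_of_eq convex_conic_hull)

lemma scaleR_in_cone_of: "x \<in> C \<Longrightarrow> 0 \<le> t \<Longrightarrow> t *\<^sub>R x \<in> cone_of C"
  by (auto simp: cone_of_def conic_hull_explicit)

lemma convex_hull_inner_le:
  assumes "g \<in> convex hull E" "\<And>e. e \<in> E \<Longrightarrow> e \<bullet> d \<le> c"
  shows "g \<bullet> d \<le> c"
proof -
  have "convex hull E \<subseteq> {g. d \<bullet> g \<le> c}"
    using assms(2) by (intro hull_minimal convex_halfspace_le) (auto simp: inner_commute)
  with assms(1) show ?thesis by (auto simp: inner_commute)
qed

lemma cone_of_inner_nonneg:
  assumes "c \<in> cone_of (convex hull E)" "\<And>e. e \<in> E \<Longrightarrow> 0 \<le> e \<bullet> d"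
  shows "0 \<le> c \<bullet> d"
proof -
  have "0 \<le> g \<bullet> d" if "g \<in> convex hull E" for g
    using convex_hull_inner_le[OF that, of "- d" 0] assms(2) by simp
  with assms(1) show ?thesis
    by (auto simp: cone_of_def conic_hull_explicit)
qed

lemma convex_subdiff_set: "convex (subdiff_set A z)"
proof (rule convexI)
  fix p q and u v :: real
  assume uv: "0 \<le> u" "0 \<le> v" "u + v = 1"
  let ?G = "convex hull active_vecs A z" and ?S = "span {vec 1} \<times> span {vec 1}"
    and ?C = "cone_of (convex hull (unit_vec ` J_set z))"
  assume "p \<in> subdiff_set A z" "q \<in> subdiff_set A z"
  then obtain g s c g' s' c' where p: "p = g + s - c" "g \<in> ?G" "s \<in> ?S" "c \<in> ?C"
    and q: "q = g' + s' - c'" "g' \<in> ?G" "s' \<in> ?S" "c' \<in> ?C"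
    unfolding subdiff_set_eq by blast
  have S: "convex ?S"
    by (intro convex_Times subspace_imp_convex subspace_span)
  have C: "convex ?C"
    by (intro convex_cone_of convex_convex_hull)
  have "u *\<^sub>R p + v *\<^sub>R q
      = (u *\<^sub>R g + v *\<^sub>R g') + (u *\<^sub>R s + v *\<^sub>R s') - (u *\<^sub>R c + v *\<^sub>R c')"
    by (simp add: p(1) q(1) algebra_simps)
  also have "\<dots> \<in> subdiff_set A z"
    using convexD[OF convex_convex_hull p(2) q(2) uv] convexD[OF S p(3) q(3) uv]
      convexD[OF C p(4) q(4) uv] by (rule subdiff_setI)
  finally show "u *\<^sub>R p + v *\<^sub>R q \<in> subdiff_set A z" .
qed

lemma subdiff_set_nonempty: "subdiff_set A z \<noteq> {}"
proof -
  obtain i k where "(avec A i, bvec A k) \<in> active_vecs A z"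
    using ex_active[of A z] by (auto simp: active_vecs_def)
  then have "(avec A i, bvec A k) + 0 - 0 \<in> subdiff_set A z"
    by (intro subdiff_setI hull_inc zero_in_span_Times zero_in_cone_of)
  then show ?thesis by blast
qed

text \<open>Coordinates sum to 1 in each factor, so multiples of the all-ones vectors are constant
  on \<open>strategies\<close>: the span is normal to the affine hull.\<close>

lemma inner_span_ones_strategies:
  assumes "s \<in> span {vec 1} \<times> span {vec 1}" "z \<in> strategies" "w \<in> strategies"
  shows "s \<bullet> z = s \<bullet> w"
proof -
  obtain a b where "s = (a *\<^sub>R vec 1, b *\<^sub>R vec 1)"
    using assms(1) by (auto simp: span_singleton)
  with assms(2,3) show ?thesis
    by (auto simp: strategies_def prob_simplex_def inner_vec_def simp flip: sum_distrib_left)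
qed

lemma unit_vec_inner:
  "unit_vec j \<bullet> z = (case j of Inl i \<Rightarrow> fst z $ i | Inr p \<Rightarrow> snd z $ p)"
  by (cases z) (auto simp: unit_vec_def inner_axis' split: sum.split)

lemma unit_vec_inner_strategies: "z \<in> strategies \<Longrightarrow> 0 \<le> unit_vec j \<bullet> z"
  by (auto simp: unit_vec_inner strategies_def prob_simplex_def split: sum.split)

lemma J_set_iff: "j \<in> J_set z \<longleftrightarrow> unit_vec j \<bullet> z = 0"
  by (cases z; cases j) (auto simp: J_set_def unit_vec_inner)

text \<open>Activity gives the value of \<open>g\<close> at \<open>z\<close>, \<open>s\<close>
  cancels, and \<open>c\<close> vanishes at \<open>z\<close> but is nonnegative at \<open>w\<close>.
  The term \<open>g \<bullet> w\<close> is kept because it is estimated in two ways: by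
  \<open>gap_fun A w\<close> for the subgradient inequality, and as 0 at a suitable mixed
  strategy.\<close>

lemma subdiff_set_inner_diff_le:
  assumes g: "g \<in> convex hull active_vecs A z" and s: "s \<in> span {vec 1} \<times> span {vec 1}"
    and c: "c \<in> cone_of (convex hull (unit_vec ` J_set z))"
    and z: "z \<in> strategies" and w: "w \<in> strategies"
  shows "(g + s - c) \<bullet> (w - z) \<le> g \<bullet> w - gap_fun A z"
proof -
  have "g \<bullet> (- z) \<le> - gap_fun A z"
    by (rule convex_hull_inner_le[OF g]) (auto simp: active_vecs_def)
  moreover have "0 \<le> c \<bullet> (- z)"
    by (rule cone_of_inner_nonneg[OF c]) (auto simp: J_set_iff)
  moreover have "0 \<le> c \<bullet> w"
    using w by (intro cone_of_inner_nonneg[OF c]) (auto simp: unit_vec_inner_strategies)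
  ultimately show ?thesis
    using inner_span_ones_strategies[OF s z w] by (simp add: algebra_simps)
qed

lemma subgradient_inequality:
  assumes "p \<in> subdiff_set A z" "z \<in> strategies" "w \<in> strategies"
  shows "gap_fun A z + p \<bullet> (w - z) \<le> gap_fun A w"
proof -
  obtain g s c where p: "p = g + s - c" and gsc: "g \<in> convex hull active_vecs A z"
    "s \<in> span {vec 1} \<times> span {vec 1}" "c \<in> cone_of (convex hull (unit_vec ` J_set z))"
    using assms(1) unfolding subdiff_set_eq by blast
  have "g \<bullet> w \<le> gap_fun A w"
    by (rule convex_hull_inner_le[OF gsc(1)]) (use gap_fun_ge[of A _ _ w] in \<open>auto simp: active_vecs_def\<close>)
  with subdiff_set_inner_diff_le[OF gsc assms(2,3)] show ?thesis
    by (simp add: p)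
qed

text \<open>The map from \<open>(u, v)\<close> to \<open>g\<close> is linear and sends pairs of pure
  strategies to the vectors \<open>(avec A i, bvec A k)\<close>, so the image of
  \<open>strategies\<close> is a convex set containing all of them.\<close>

lemma convex_hull_active_vecs_mixed:
  fixes A :: "real^'n::finite^'m::finite"
  assumes "g \<in> convex hull active_vecs A z"
  obtains u v where "(u, v) \<in> strategies" "g = (A *v v, - (u v* A))"
proof -
  let ?h = "\<lambda>w :: (real^'m) \<times> (real^'n). (A *v snd w, - (fst w v* A))"
  have lin: "linear ?h"
    by (rule linearI)
      (auto simp: matrix_vector_right_distrib vector_matrix_left_distrib
        matrix_vector_mult_scaleR scaleR_vector_matrix_assoc)
  have "active_vecs A z \<subseteq> ?h ` strategies"
  proof
    fix e assume "e \<in> active_vecs A z"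
    then obtain i k where e: "e = (avec A i, bvec A k)"
      by (auto simp: active_vecs_def)
    have "e = ?h (axis k 1, axis i 1)"
      by (simp add: e avec_def bvec_def matrix_vector_mult_basis flip: transpose_matrix_vector)
    then show "e \<in> ?h ` strategies"
      by (rule image_eqI) (simp add: strategies_def axis_in_prob_simplex)
  qed
  then have "convex hull active_vecs A z \<subseteq> ?h ` strategies"
    by (intro hull_minimal convex_linear_image lin convex_strategies)
  with assms that show thesis by auto
qed

lemma gap_fun_le_norm_subgradient:
  fixes A :: "real^'n::finite^'m::finite"
  assumes "p \<in> subdiff_set A z" "z \<in> strategies"
  shows "gap_fun A z \<le> 4 * norm p"
proof -
  obtain g s c where p: "p = g + s - c" and gsc: "g \<in> convex hull active_vecs A z"
    "s \<in> span {vec 1} \<times> span {vec 1}" "c \<in> cone_of (convex hull (unit_vec ` J_set z))"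
    using assms(1) unfolding subdiff_set_eq by blast
  obtain u v where uv: "(u, v) \<in> strategies" "g = (A *v v, - (u v* A))"
    using convex_hull_active_vecs_mixed[OF gsc(1)] .
  \<comment> \<open>The map from \<open>(u, v)\<close> to \<open>g\<close> is skew-symmetric: both
    terms are the same bilinear form with opposite signs.\<close>
  have "g \<bullet> (u, v) = 0"
    by (simp add: uv(2) dot_lmul_matrix inner_commute[of "A *v v"])
  with subdiff_set_inner_diff_le[OF gsc assms(2) uv(1)]
  have "gap_fun A z \<le> p \<bullet> (z - (u, v))"
    unfolding p by (simp only: inner_diff_right)
  also have "\<dots> \<le> norm p * norm (z - (u, v))"
    by (rule norm_cauchy_schwarz)
  \<comment> \<open>Both points have norm at most 2.\<close>
  also have "\<dots> \<le> norm p * 4"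
    using norm_triangle_ineq4[of z "(u, v)"] norm_strategies_le[OF assms(2)]
      norm_strategies_le[OF uv(1)]
    by (intro mult_left_mono) auto
  finally show ?thesis by simp
qed

section \<open>Descent\<close>

lemma infdist_greatest:
  assumes "S \<noteq> {}" "\<And>y. y \<in> S \<Longrightarrow> c \<le> dist x y"
  shows "c \<le> infdist x S"
  using assms by (simp add: infdist_def cINF_greatest)

text \<open>Strict slack absorbs any slope for small \<open>t\<close>; without slack the slope
  itself must suffice. As there are finitely many sign constraints and linear pieces, one step size
  serves them all.\<close>

lemma eventually_affine_le:
  fixes a b c q :: real
  assumes "a < c \<or> a = c \<and> b \<le> - q"
  shows "\<forall>\<^sub>F t in at_right 0. a + t * b \<le> c - t * q"
  using assms
proof
  assume "a < c"
  have "((\<lambda>t. a + t * b - (c - t * q)) \<longlongrightarrow> a + 0 * b - (c - 0 * q)) (at_right 0)"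
    by (intro tendsto_intros)
  then have "\<forall>\<^sub>F t in at_right 0. a + t * b - (c - t * q) < 0"
    using \<open>a < c\<close> by (intro order_tendstoD) auto
  then show ?thesis by eventually_elim simp
next
  assume "a = c \<and> b \<le> - q"
  moreover have "\<forall>\<^sub>F t :: real in at_right 0. 0 < t"
    by (simp add: eventually_at_filter)
  ultimately show ?thesis
    using mult_left_mono[of b "- q"] by (auto elim!: eventually_mono)
qed

lemma eventually_feasible:
  assumes z: "z \<in> strategies" and d: "d \<bullet> (vec 1, 0) = 0" "d \<bullet> (0, vec 1) = 0"
    and J: "\<And>j. j \<in> J_set z \<Longrightarrow> 0 \<le> unit_vec j \<bullet> d"
  shows "\<forall>\<^sub>F t in at_right 0. z + t *\<^sub>R d \<in> strategies"
proof -
  have "\<forall>\<^sub>F t in at_right 0. - (unit_vec j \<bullet> z) + t * (- (unit_vec j \<bullet> d)) \<le> 0 - t * 0" for j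
    using J[of j] unit_vec_inner_strategies[OF z, of j]
    by (intro eventually_affine_le) (auto simp: J_set_iff)
  then have "\<forall>\<^sub>F t in at_right 0. \<forall>j. - (unit_vec j \<bullet> z) + t * (- (unit_vec j \<bullet> d)) \<le> 0 - t * 0"
    by (rule eventually_all_finite)
  then show ?thesis
  proof eventually_elim
    case (elim t)
    have "0 \<le> unit_vec j \<bullet> (z + t *\<^sub>R d)" for j
      using spec[OF elim, of j] by (simp add: inner_add_right)
    from this[of "Inl _"] this[of "Inr _"]
    have "0 \<le> fst z $ i + t * fst d $ i" "0 \<le> snd z $ k + t * snd d $ k" for i k
      by (simp_all add: unit_vec_inner)
    moreover have "(\<Sum>i\<in>UNIV. fst d $ i) = 0" "(\<Sum>k\<in>UNIV. snd d $ k) = 0"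
      using d by (cases d; simp add: inner_vec_def)+
    ultimately show ?case
      using z by (cases z; cases d)
        (auto simp: strategies_def prob_simplex_def sum.distrib simp flip: sum_distrib_left)
  qed
qed

text \<open>Along \<open>- p\<close>, with \<open>p\<close> the projection of 0 onto the closed
  subdifferential, the gap falls at rate at least \<open>(norm p)\<^sup>2\<close> while the distance
  grows at rate \<open>norm p\<close>. The gain per unit of distance is thus at least
  \<open>norm p\<close>, which exceeds \<open>\<epsilon>\<close>.\<close>

lemma descent:
  fixes A :: "real^'n::finite^'m::finite"
  assumes z: "z \<in> strategies" and \<epsilon>: "0 \<le> \<epsilon>" "\<epsilon> < infdist 0 (subdiff_set A z)"
  obtains w where "w \<in> strategies" "gap_fun A w + \<epsilon> * dist w z < gap_fun A z"
proof -
  let ?D = "subdiff_set A z"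
  \<comment> \<open>The closure has the same distance to 0 and guarantees that the projection is
    attained.\<close>
  define p where "p = closest_point (closure ?D) 0"
  have "p \<in> closure ?D"
    unfolding p_def using subdiff_set_nonempty[of A z] by (intro closest_point_in_set) auto
  then have "infdist 0 (closure ?D) \<le> norm p"
    using infdist_le[of p "closure ?D" 0] by simp
  then have p: "\<epsilon> < norm p"
    using \<epsilon> by (simp add: infdist_eq_setdist)
  \<comment> \<open>This is the variational inequality of the projection: the segment from
    \<open>p\<close> to \<open>g\<close> makes an obtuse or right angle with the direction from
    \<open>p\<close> to 0.\<close>
  have D: "g \<bullet> (- p) \<le> - (norm p)\<^sup>2" if "g \<in> ?D" for g
    using closest_point_dot[of "closure ?D" g 0] that closure_subset[of ?D]
    by (auto simp: p_def[symmetric] convex_closure convex_subdiff_set power2_norm_eq_inner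
        inner_commute algebra_simps)
  define d where "d = - p"
  have gsc: "(g + s - c) \<bullet> d \<le> - (norm p)\<^sup>2"
    if "g \<in> active_vecs A z" "s \<in> span {vec 1} \<times> span {vec 1}"
      "c \<in> cone_of (convex hull (unit_vec ` J_set z))" for g s c
    unfolding d_def by (intro D subdiff_setI hull_inc that)
  obtain g where g: "g \<in> active_vecs A z"
    using ex_active[of A z] by (auto simp: active_vecs_def)
  \<comment> \<open>The subdifferential contains \<open>g\<close> plus a cone, on which a functional that is bounded above
    must be nonpositive.\<close>
  have ray: "r \<bullet> d \<le> 0" if "\<And>t. 0 \<le> t \<Longrightarrow> g \<bullet> d + t * (r \<bullet> d) \<le> - (norm p)\<^sup>2" for r
  proof (rule ccontr)
    assume r: "\<not> r \<bullet> d \<le> 0"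
    \<comment> \<open>This makes \<open>t * (r \<bullet> d)\<close> exceed the absolute value of
      \<open>g \<bullet> d\<close> by 1, so the left side of the assumed bound becomes
      positive.\<close>
    define t where "t = \<bar>g \<bullet> d\<bar> / (r \<bullet> d) + 1 / (r \<bullet> d)"
    have "0 \<le> t" "t * (r \<bullet> d) = \<bar>g \<bullet> d\<bar> + 1"
      using r by (simp_all add: t_def field_simps)
    moreover have "0 \<le> (norm p)\<^sup>2" by simp
    ultimately show False
      using that[of t] by linarith
  qed
  have span: "s \<bullet> d \<le> 0" if "s \<in> span {vec 1} \<times> span {vec 1}" for s
  proof (rule ray)
    fix t :: real
    have "t *\<^sub>R s \<in> span {vec 1} \<times> span {vec 1}"
      using that by (auto intro: span_scale)
    from gsc[OF g this zero_in_cone_of]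
    show "g \<bullet> d + t * (s \<bullet> d) \<le> - (norm p)\<^sup>2"
      by (simp add: inner_add_left)
  qed
  have "vec 1 \<in> span {vec 1 :: real^'m}" "- vec 1 \<in> span {vec 1 :: real^'m}"
    "vec 1 \<in> span {vec 1 :: real^'n}" "- vec 1 \<in> span {vec 1 :: real^'n}"
    by (auto intro: span_base span_neg)
  \<comment> \<open>The span is symmetric, so nonpositivity at a vector and at its negative forces
    orthogonality, and moving along \<open>d\<close> keeps both coordinate sums.\<close>
  then have "d \<bullet> (vec 1, 0) = 0" "d \<bullet> (0, vec 1) = 0"
    using span[of "(vec 1, 0)"] span[of "- (vec 1, 0)"] span[of "(0, vec 1)"] span[of "- (0, vec 1)"]
    by (auto simp: inner_prod_def inner_commute span_zero)
  moreover have "0 \<le> unit_vec j \<bullet> d" if "j \<in> J_set z" for j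
  proof -
    have "(- unit_vec j) \<bullet> d \<le> 0"
    proof (rule ray)
      fix t :: real assume "0 \<le> t"
      then have "t *\<^sub>R unit_vec j \<in> cone_of (convex hull (unit_vec ` J_set z))"
        using that by (intro scaleR_in_cone_of hull_inc) auto
      from gsc[OF g zero_in_span_Times this]
      show "g \<bullet> d + t * (- unit_vec j \<bullet> d) \<le> - (norm p)\<^sup>2"
        by (simp add: inner_diff_left)
    qed
    then show ?thesis by simp
  qed
  ultimately have ev1: "\<forall>\<^sub>F t in at_right 0. z + t *\<^sub>R d \<in> strategies"
    by (rule eventually_feasible[OF z])
  have "\<forall>\<^sub>F t in at_right 0. (avec A i, bvec A k) \<bullet> z + t * ((avec A i, bvec A k) \<bullet> d)
      \<le> gap_fun A z - t * (norm p)\<^sup>2" for i k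
  proof (rule eventually_affine_le)
    show "(avec A i, bvec A k) \<bullet> z < gap_fun A z \<or>
        (avec A i, bvec A k) \<bullet> z = gap_fun A z \<and> (avec A i, bvec A k) \<bullet> d \<le> - (norm p)\<^sup>2"
    proof (cases "(avec A i, bvec A k) \<bullet> z = gap_fun A z")
      case True
      then have "(avec A i, bvec A k) \<in> active_vecs A z"
        by (auto simp: active_vecs_def)
      from gsc[OF this zero_in_span_Times zero_in_cone_of] True show ?thesis
        by simp
    next
      case False
      with gap_fun_ge[of A i k z] show ?thesis by linarith
    qed
  qed
  then have ev2: "\<forall>\<^sub>F t in at_right 0. \<forall>i k. (avec A i, bvec A k) \<bullet> z
      + t * ((avec A i, bvec A k) \<bullet> d) \<le> gap_fun A z - t * (norm p)\<^sup>2"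
    by (intro eventually_all_finite)
  have "\<forall>\<^sub>F t :: real in at_right 0. 0 < t"
    by (simp add: eventually_at_filter)
  with ev1 ev2 have "\<forall>\<^sub>F t in at_right 0. z + t *\<^sub>R d \<in> strategies \<and>
      gap_fun A (z + t *\<^sub>R d) \<le> gap_fun A z - t * (norm p)\<^sup>2 \<and> 0 < t"
    by eventually_elim (simp only: gap_fun_le_iff inner_add_right inner_scaleR_right, blast)
  then obtain t where t: "z + t *\<^sub>R d \<in> strategies" "0 < t"
    "gap_fun A (z + t *\<^sub>R d) \<le> gap_fun A z - t * (norm p)\<^sup>2"
    using eventually_happens'[OF trivial_limit_at_right_real] by blast
  have "\<epsilon> * dist (z + t *\<^sub>R d) z = t * (\<epsilon> * norm p)"
    using t by (simp add: dist_norm d_def)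
  also have "\<dots> < t * (norm p * norm p)"
    using p \<epsilon> t by (intro mult_strict_left_mono mult_strict_right_mono) auto
  finally show thesis
    using t that[of "z + t *\<^sub>R d"] by (simp add: power2_eq_square)
qed

text \<open>This contains the minimax theorem. It is needed because \<open>infdist\<close> to the
  empty set is 0, which would make every error bound trivial.\<close>

lemma solution_set_nonempty:
  fixes A :: "real^'n::finite^'m::finite"
  shows "solution_set A \<noteq> {}"
proof -
  obtain z where z: "z \<in> strategies" "\<And>w. w \<in> strategies \<Longrightarrow> gap_fun A z \<le> gap_fun A w"
    using continuous_attains_inf[OF compact_strategies strategies_nonempty continuous_on_gap_fun]
    by blast
  have "gap_fun A z = 0"
  proof (rule ccontr)
    assume "gap_fun A z \<noteq> 0"
    then have pos: "0 < gap_fun A z"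
      using gap_fun_nonneg[OF z(1), of A] by linarith
    have "gap_fun A z / 4 \<le> infdist 0 (subdiff_set A z)"
    proof (rule infdist_greatest[OF subdiff_set_nonempty])
      fix p assume "p \<in> subdiff_set A z"
      from gap_fun_le_norm_subgradient[OF this z(1)] show "gap_fun A z / 4 \<le> dist 0 p"
        by simp
    qed
    with pos have "0 < infdist 0 (subdiff_set A z)" by linarith
    then obtain w where "w \<in> strategies" "gap_fun A w + 0 * dist w z < gap_fun A z"
      using descent[OF z(1) order_refl] by blast
    with z(2)[of w] show False by simp
  qed
  with z(1) have "z \<in> solution_set A" by (simp add: solution_set_def)
  then show ?thesis by blast
qed

section \<open>Error bounds\<close>

lemma error_bound_imp_infdist_ge:
  assumes \<kappa>: "\<forall>z\<in>strategies. infdist z (solution_set A) \<le> \<kappa> * gap_fun A z"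
    and z: "z \<in> strategies - solution_set A"
  shows "1 \<le> \<kappa> * infdist 0 (subdiff_set A z)"
proof -
  have F: "0 < gap_fun A z"
    using z gap_fun_nonneg[of z A] by (auto simp: solution_set_def less_le)
  have closed: "closed (solution_set A)"
    unfolding solution_set_def
    using continuous_closed_preimage_constant[OF continuous_on_gap_fun
        compact_imp_closed[OF compact_strategies]] .
  obtain s where s: "s \<in> solution_set A" "infdist z (solution_set A) = dist z s"
    using infdist_attains_inf[OF closed solution_set_nonempty] .
  then have "dist z s \<le> \<kappa> * gap_fun A z" "z \<noteq> s"
    using \<kappa> z by auto
  \<comment> \<open>The sign of \<open>\<kappa>\<close> is not assumed; it follows from the positive
    distance on the left of the error bound.\<close>
  then have pos: "0 < \<kappa>"
    using F by (metis DiffD2 dist_pos_lt less_le_trans zero_less_mult_pos2)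
  have "1 / \<kappa> \<le> norm g" if g: "g \<in> subdiff_set A z" for g
  proof -
    have "gap_fun A z \<le> g \<bullet> (z - s)"
      using subgradient_inequality[OF g, of s] z s(1) by (auto simp: solution_set_def inner_diff_right)
    also have "\<dots> \<le> norm g * dist z s"
      unfolding dist_norm by (rule norm_cauchy_schwarz)
    also have "\<dots> \<le> norm g * (\<kappa> * gap_fun A z)"
      using \<open>dist z s \<le> \<kappa> * gap_fun A z\<close> by (intro mult_left_mono) auto
    finally have "1 * gap_fun A z \<le> (norm g * \<kappa>) * gap_fun A z"
      by simp
    then have "1 \<le> norm g * \<kappa>"
      using F by (simp only: mult_le_cancel_right_pos)
    with pos show ?thesis by (simp add: field_simps)
  qed
  then have "1 / \<kappa> \<le> infdist 0 (subdiff_set A z)"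
    by (intro infdist_greatest subdiff_set_nonempty) simp
  with pos show ?thesis by (simp add: field_simps)
qed

lemma error_bound_violated_imp_small_subgradients:
  assumes "0 < \<kappa>" and z: "z \<in> strategies"
    and far: "\<kappa> * gap_fun A z < infdist z (solution_set A)"
  obtains w where "w \<in> strategies - solution_set A" "\<kappa> * infdist 0 (subdiff_set A w) \<le> 1"
proof -
  let ?\<phi> = "\<lambda>w. gap_fun A w + 1 / \<kappa> * dist w z"
  have "continuous_on strategies ?\<phi>"
    by (intro continuous_intros continuous_on_gap_fun)
  then obtain w where w: "w \<in> strategies" "\<And>v. v \<in> strategies \<Longrightarrow> ?\<phi> w \<le> ?\<phi> v"
    using continuous_attains_inf[OF compact_strategies strategies_nonempty] by blast
  have "w \<notin> solution_set A"
  proof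
    assume S: "w \<in> solution_set A"
    \<comment> \<open>If \<open>w\<close> is a solution, only the penalty term remains at
      \<open>w\<close>, while at \<open>z\<close> the penalty vanishes.\<close>
    then have "dist z w \<le> \<kappa> * gap_fun A z"
      using w(2)[OF z] \<open>0 < \<kappa>\<close> by (simp add: solution_set_def field_simps dist_commute)
    with far infdist_le[OF S, of z] show False by linarith
  qed
  moreover have "infdist 0 (subdiff_set A w) \<le> 1 / \<kappa>"
  proof (rule ccontr)
    assume "\<not> infdist 0 (subdiff_set A w) \<le> 1 / \<kappa>"
    then obtain v where v: "v \<in> strategies" "gap_fun A v + 1 / \<kappa> * dist v w < gap_fun A w"
      using descent[OF w(1), of "1 / \<kappa>" A] \<open>0 < \<kappa>\<close> by auto
    \<comment> \<open>Moving from \<open>w\<close> to \<open>v\<close> raises the penalty by at most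
      \<open>1 / \<kappa> * dist v w\<close>, less than the drop in the gap, contradicting the
      minimality of \<open>w\<close>.\<close>
    have "1 / \<kappa> * dist v z \<le> 1 / \<kappa> * (dist v w + dist w z)"
      using \<open>0 < \<kappa>\<close> by (intro mult_left_mono dist_triangle) auto
    with v w(2)[OF v(1)] show False
      unfolding distrib_left by linarith
  qed
  ultimately show thesis
    using w(1) \<open>0 < \<kappa>\<close> that[of w] by (simp add: field_simps)
qed

theorem theorem1p3:
  fixes A :: "real^'n::finite^'m::finite"
  assumes "strategies - solution_set A \<noteq> {}"
  shows "cond_measure A =
    (SUP z\<in>strategies - solution_set A. inverse (ereal (infdist 0 (subdiff_set A z))))"
proof (rule antisym)
  let ?r = "\<lambda>z. inverse (ereal (infdist 0 (subdiff_set A z)))"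
  let ?T = "strategies - solution_set A"
  show "cond_measure A \<le> (SUP z\<in>?T. ?r z)"
  \<comment> \<open>Comparing with a bound strictly above the supremum yields a positive
    \<open>\<kappa>\<close> to divide by, and strictness supplies the contradiction.\<close>
  proof (rule dense_ge)
    fix y assume y: "(SUP z\<in>?T. ?r z) < y"
    \<comment> \<open>A point of the index set is needed for nonnegativity, since the supremum of
      the empty set in \<open>ereal\<close> is minus infinity.\<close>
    obtain z0 where "z0 \<in> ?T" using assms by blast
    then have "0 \<le> (SUP z\<in>?T. ?r z)"
      by (intro SUP_upper2[of z0]) (auto intro!: inverse_ereal_ge0I simp: infdist_nonneg)
    with y have "0 < y" by order
    show "cond_measure A \<le> y"
    proof (cases y)
      case (real \<kappa>)
      with \<open>0 < y\<close> have \<kappa>: "0 < \<kappa>" by simp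
      have "infdist z (solution_set A) \<le> \<kappa> * gap_fun A z" if z: "z \<in> strategies" for z
      proof (rule ccontr)
        assume "\<not> ?thesis"
        then have "\<kappa> * gap_fun A z < infdist z (solution_set A)" by simp
        then obtain w where w: "w \<in> ?T" "\<kappa> * infdist 0 (subdiff_set A w) \<le> 1"
          using error_bound_violated_imp_small_subgradients[OF \<kappa> z] by metis
        \<comment> \<open>This includes distance 0, whose inverse in \<open>ereal\<close> is
          infinity.\<close>
        have "y \<le> ?r w"
          using w(2) \<kappa> infdist_nonneg[of 0 "subdiff_set A w"]
          by (auto simp: real field_simps)
        with y SUP_upper[OF w(1), of ?r] show False by order
      qed
      then show ?thesis
        unfolding cond_measure_def real using \<kappa> by (intro Inf_lower imageI) auto
    qed (use \<open>0 < y\<close> in auto)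
  qed
  show "(SUP z\<in>?T. ?r z) \<le> cond_measure A"
    unfolding cond_measure_def
  proof (intro SUP_least Inf_greatest, elim imageE CollectE conjE)
    fix z \<kappa>' \<kappa>
    assume "z \<in> ?T" "\<kappa>' = ereal \<kappa>" "0 \<le> \<kappa>"
      "\<forall>z\<in>strategies. infdist z (solution_set A) \<le> \<kappa> * gap_fun A z"
    moreover from this have "1 \<le> \<kappa> * infdist 0 (subdiff_set A z)"
      by (intro error_bound_imp_infdist_ge)
    \<comment> \<open>Distance 0, with infinite inverse, is excluded by the product form of the
      preceding inequality.\<close>
    ultimately show "?r z \<le> \<kappa>'"
      using infdist_nonneg[of 0 "subdiff_set A z"]
      by (cases "infdist 0 (subdiff_set A z) = 0") (auto simp: field_simps)
  qed
qed

end
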